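(* Let $(J_5,\circ)$ be the Jordan algebra over $\mathbb{C}$ with basis $\{e_1,e_2\}$ and $e_1\circ e_1=2e_2$, $e_1\circ e_2=e_2\circ e_1=0$, $e_2\circ e_2=0$. Any Rota-Baxter operator on $(J_5,\circ)$ is of one of the following forms: (a) $\begin{pmatrix} 0&0\\ r_{21}&r_{22}\end{pmatrix}$ with $r_{21},r_{22}\in\mathbb{C}$, in which case the induced pre-Jordan algebra is isomorphic to $J_{6,1}$; (b) $\begin{pmatrix} 2r_{22}&0\\ r_{21}&r_{22}\end{pmatrix}$ with $r_{21},r_{22}\in\mathbb{C}$, $r_{22}\neq0$, in which case the induced pre-Jordan algebra is isomorphic to $J_{5,1}$.
   Context: A Rota-Baxter operator (of weight $0$) on a Jordan algebra $(J,\circ)$ is a linear map $R:J\to J$ with $R(x)\circ R(y)=R(R(x)\circ y+x\circ R(y))$ for all $x,y\in J$. The matrix $(r_{ij})$ of $R$ in a basis $\{e_i\}$ is defined by $R(e_i)=\sum_j r_{ji}e_j$. The pre-Jordan algebra induced by $R$ is $J$ with the multiplication $x\cdot y:=R(x)\circ y$. Isomorphisms are bijective linear maps preserving the multiplication $\cdot$. $J_{5,1}$ is the algebra with basis $\{e_1,e_2\}$, $e_1\cdot e_1=e_2$ and all other products of basis elements zero; $J_{6,1}$ is the $2$-dimensional algebra with zero multiplication. *)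

theory Defs
  imports "HOL-Analysis.Analysis"
begin

definition bilinear_product ::
  "('k::field \<Rightarrow> 'a::ab_group_add \<Rightarrow> 'a) \<Rightarrow> ('a \<Rightarrow> 'a \<Rightarrow> 'a) \<Rightarrow> bool" where
  "bilinear_product sc mul \<longleftrightarrow>
     (\<forall>x. Vector_Spaces.linear sc sc (mul x)) \<and>
     (\<forall>y. Vector_Spaces.linear sc sc (\<lambda>x. mul x y))"

definition jordan_algebra ::
  "('k::field \<Rightarrow> 'a::ab_group_add \<Rightarrow> 'a) \<Rightarrow> ('a \<Rightarrow> 'a \<Rightarrow> 'a) \<Rightarrow> bool" where
  "jordan_algebra sc mul \<longleftrightarrow>
     bilinear_product sc mul \<and>
     (\<forall>x y. mul x y = mul y x) \<and>
     (\<forall>x y. mul (mul (mul x x) y) x = mul (mul x x) (mul y x))"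

definition rota_baxter_operator ::
  "('k::field \<Rightarrow> 'a::ab_group_add \<Rightarrow> 'a) \<Rightarrow> ('a \<Rightarrow> 'a \<Rightarrow> 'a) \<Rightarrow> ('a \<Rightarrow> 'a) \<Rightarrow> bool" where
  "rota_baxter_operator sc mul R \<longleftrightarrow>
     jordan_algebra sc mul \<and>
     Vector_Spaces.linear sc sc R \<and>
     (\<forall>x y. mul (R x) (R y) = R (mul (R x) y + mul x (R y)))"

definition induced_product :: "('a \<Rightarrow> 'a \<Rightarrow> 'a) \<Rightarrow> ('a \<Rightarrow> 'a) \<Rightarrow> 'a \<Rightarrow> 'a \<Rightarrow> 'a" where
  "induced_product mul R x y = mul (R x) y"

definition isomorphic_algebras ::
  "('k::field \<Rightarrow> 'a::ab_group_add \<Rightarrow> 'a) \<Rightarrow> ('a \<Rightarrow> 'a \<Rightarrow> 'a) \<Rightarrow>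
   ('k \<Rightarrow> 'b::ab_group_add \<Rightarrow> 'b) \<Rightarrow> ('b \<Rightarrow> 'b \<Rightarrow> 'b) \<Rightarrow> bool" where
  "isomorphic_algebras sc1 mul1 sc2 mul2 \<longleftrightarrow>
     (\<exists>f. Vector_Spaces.linear sc1 sc2 f \<and> bij f \<and>
          (\<forall>x y. f (mul1 x y) = mul2 (f x) (f y)))"

text \<open>The bilinear extension of a multiplication table: \<open>c i j\<close> is the product of the
  \<open>i\<close>-th and the \<open>j\<close>-th standard basis vector.\<close>

definition table_product ::
  "('n::finite \<Rightarrow> 'n \<Rightarrow> 'k::field ^ 'n) \<Rightarrow> 'k ^ 'n \<Rightarrow> 'k ^ 'n \<Rightarrow> 'k ^ 'n" where
  "table_product c x y = (\<Sum>i\<in>UNIV. \<Sum>j\<in>UNIV. (x $ i * y $ j) *s c i j)"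

text \<open>All two-dimensional algebras live on \<open>complex ^ 2\<close> with the standard basis as
  \<open>{e\<^sub>1, e\<^sub>2}\<close>. The entry \<open>matrix R $ j $ i\<close> is the \<open>j\<close>-th coordinate of the image of the
  \<open>i\<close>-th basis vector, so the library's \<open>matrix\<close> follows the convention
  \<open>R(e\<^sub>i) = \<Sum>\<^sub>j r\<^sub>j\<^sub>i e\<^sub>j\<close>.\<close>

abbreviation e1 :: "complex ^ 2" where "e1 \<equiv> axis 1 1"
abbreviation e2 :: "complex ^ 2" where "e2 \<equiv> axis 2 1"

definition J5_product :: "complex ^ 2 \<Rightarrow> complex ^ 2 \<Rightarrow> complex ^ 2" where
  "J5_product = table_product (\<lambda>i j. if i = 1 \<and> j = 1 then 2 *s e2 else 0)"

definition J51_product :: "complex ^ 2 \<Rightarrow> complex ^ 2 \<Rightarrow> complex ^ 2" where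
  "J51_product = table_product (\<lambda>i j. if i = 1 \<and> j = 1 then e2 else 0)"

definition J61_product :: "complex ^ 2 \<Rightarrow> complex ^ 2 \<Rightarrow> complex ^ 2" where
  "J61_product x y = 0"

lemma J5_product_basis:
  "J5_product e1 e1 = 2 *s e2" "J5_product e1 e2 = 0"
  "J5_product e2 e1 = 0" "J5_product e2 e2 = 0"
  by (simp_all add: J5_product_def table_product_def sum_2 axis_def vec_eq_iff forall_2)

lemma J51_product_basis:
  "J51_product e1 e1 = e2" "J51_product e1 e2 = 0"
  "J51_product e2 e1 = 0" "J51_product e2 e2 = 0"
  by (simp_all add: J51_product_def table_product_def sum_2 axis_def vec_eq_iff forall_2)

lemma jordan_algebra_J5: "jordan_algebra (*s) J5_product"
  unfolding jordan_algebra_def bilinear_product_def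
  by (auto intro!: Vector_Spaces.linear_iff[THEN iffD2]
      simp: vec.vector_space_axioms J5_product_def table_product_def sum_2 axis_def
        vec_eq_iff forall_2 algebra_simps)

end

theory Submission
  imports Defs
begin

text \<open>
  The product of the algebra only sees first coordinates: \<open>x \<circ> y = 2 x\<^sub>1 y\<^sub>1 e\<^sub>2\<close>. Write
  \<open>R e\<^sub>1 = a e\<^sub>1 + b e\<^sub>2\<close> and \<open>R e\<^sub>2 = c e\<^sub>1 + d e\<^sub>2\<close>. The Rota-Baxter identity at
  \<open>(e\<^sub>2, e\<^sub>2)\<close> reads \<open>2 c\<^sup>2 e\<^sub>2 = R(0) = 0\<close>, because \<open>e\<^sub>2\<close> annihilates the algebra; hence
  \<open>c = 0\<close>. At \<open>(e\<^sub>1, e\<^sub>1)\<close> it reads \<open>2 a\<^sup>2 e\<^sub>2 = R(4 a e\<^sub>2) = 4 a d e\<^sub>2\<close>, so \<open>a = 0\<close> or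
  \<open>a = 2 d\<close>. These two alternatives are the two matrix shapes, where \<open>a = 0\<close> absorbs the
  overlap \<open>a = d = 0\<close>.

  As \<open>c = 0\<close>, the first coordinate of \<open>R x\<close> is \<open>a x\<^sub>1\<close>, so the induced product is
  \<open>2 a x\<^sub>1 y\<^sub>1 e\<^sub>2\<close>. It vanishes for \<open>a = 0\<close>; otherwise it is a nonzero multiple of the
  product with \<open>e\<^sub>1 e\<^sub>1 = e\<^sub>2\<close>, and rescaling \<open>e\<^sub>2\<close> removes the factor.
\<close>

lemma J5_product_eq: "J5_product x y = (2 * x $ 1 * y $ 1) *s e2"
  by (simp add: J5_product_def table_product_def sum_2 axis_def vec_eq_iff forall_2)

lemma J51_product_eq: "J51_product x y = (x $ 1 * y $ 1) *s e2"
  by (simp add: J51_product_def table_product_def sum_2 axis_def vec_eq_iff forall_2)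

lemma matrix_2_eq:
  fixes R :: "complex ^ 2 \<Rightarrow> complex ^ 2"
  shows "matrix R = vector [vector [R e1 $ 1, R e2 $ 1], vector [R e1 $ 2, R e2 $ 2]]"
  by (simp add: matrix_def vec_eq_iff forall_2)

lemma rota_baxter_J5_coordinates:
  assumes "rota_baxter_operator (*s) J5_product R"
  shows "R e2 $ 1 = 0" and "R e1 $ 1 = 0 \<or> R e1 $ 1 = 2 * R e2 $ 2"
    and "R x $ 1 = R e1 $ 1 * x $ 1"
proof -
  have lin: "Vector_Spaces.linear (*s) (*s) R"
    and RB: "J5_product (R x) (R y) = R (J5_product (R x) y + J5_product x (R y))" for x y
    using assms by (auto simp: rota_baxter_operator_def)
  interpret R: Vector_Spaces.linear "(*s)" "(*s)" R
    by (fact lin)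
  show c: "R e2 $ 1 = 0"
    using arg_cong[OF RB[of e2 e2], of "\<lambda>v. v $ 2"]
    by (simp add: J5_product_eq R.zero axis_def)
  have "J5_product (R e1) e1 + J5_product e1 (R e1) = (4 * R e1 $ 1) *s e2"
    by (simp add: J5_product_eq vec_eq_iff forall_2 axis_def)
  then have "R e1 $ 1 * R e1 $ 1 = 2 * R e1 $ 1 * R e2 $ 2"
    using arg_cong[OF RB[of e1 e1], of "\<lambda>v. v $ 2"]
    by (simp add: J5_product_eq R.scale)
  then show "R e1 $ 1 = 0 \<or> R e1 $ 1 = 2 * R e2 $ 2"
    by auto
  have "x = x $ 1 *s e1 + x $ 2 *s e2"
    by (simp add: vec_eq_iff forall_2 axis_def)
  then have "R x = x $ 1 *s R e1 + x $ 2 *s R e2"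
    by (metis R.add R.scale)
  then show "R x $ 1 = R e1 $ 1 * x $ 1"
    using c by simp
qed

text \<open>The isomorphism fixes \<open>e\<^sub>1\<close> and maps \<open>e\<^sub>2\<close> to \<open>e\<^sub>2 / k\<close>, because \<open>e\<^sub>1\<close> squares to
  \<open>k e\<^sub>2\<close> on one side and to \<open>e\<^sub>2\<close> on the other.\<close>

lemma isomorphic_J51_scaled:
  fixes mul :: "complex ^ 2 \<Rightarrow> complex ^ 2 \<Rightarrow> complex ^ 2"
  assumes "k \<noteq> 0" and mul: "\<And>x y. mul x y = (k * x $ 1 * y $ 1) *s e2"
  shows "isomorphic_algebras (*s) mul (*s) J51_product"
proof -
  define f g :: "complex ^ 2 \<Rightarrow> complex ^ 2"
    where "f x = vector [x $ 1, x $ 2 / k]" and "g x = vector [x $ 1, x $ 2 * k]" for x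
  have "Vector_Spaces.linear (*s) (*s) f"
    by (auto intro!: Vector_Spaces.linear_iff[THEN iffD2]
        simp: vec.vector_space_axioms f_def vec_eq_iff forall_2 add_divide_distrib)
  moreover have "bij f"
    by (rule o_bij[of g]) (auto simp: fun_eq_iff f_def g_def vec_eq_iff forall_2 \<open>k \<noteq> 0\<close>)
  moreover have "f (mul x y) = J51_product (f x) (f y)" for x y
    using \<open>k \<noteq> 0\<close> by (simp add: mul J51_product_eq f_def vec_eq_iff forall_2 axis_def)
  ultimately show ?thesis
    unfolding isomorphic_algebras_def by blast
qed

theorem proposition5p9:
  fixes R :: "complex ^ 2 \<Rightarrow> complex ^ 2"
  assumes "rota_baxter_operator (*s) J5_product R"
  shows "(\<exists>r21 r22 :: complex.
            matrix R = vector [vector [0, 0], vector [r21, r22]] \<and>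
            isomorphic_algebras (*s) (induced_product J5_product R) (*s) J61_product) \<or>
         (\<exists>r21 r22 :: complex.
            r22 \<noteq> 0 \<and>
            matrix R = vector [vector [2 * r22, 0], vector [r21, r22]] \<and>
            isomorphic_algebras (*s) (induced_product J5_product R) (*s) J51_product)"
proof -
  note coords = rota_baxter_J5_coordinates[OF assms]
  have ind: "induced_product J5_product R x y = (2 * R e1 $ 1 * x $ 1 * y $ 1) *s e2" for x y
    by (simp add: induced_product_def J5_product_eq coords(3)[of x])
  show ?thesis
  proof (cases "R e1 $ 1 = 0")
    case True
    have "isomorphic_algebras (*s) (induced_product J5_product R) (*s) J61_product"
      unfolding isomorphic_algebras_def
      by (rule exI[of _ id]) (simp add: vec.linear_id ind True J61_product_def)
    then show ?thesis
      using matrix_2_eq[of R] coords(1) True by auto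
  next
    case False
    then have a: "R e1 $ 1 = 2 * R e2 $ 2"
      using coords(2) by blast
    have "isomorphic_algebras (*s) (induced_product J5_product R) (*s) J51_product"
      using False by (intro isomorphic_J51_scaled[of "2 * R e1 $ 1"]) (simp_all add: ind)
    moreover have "R e2 $ 2 \<noteq> 0"
      using False a by auto
    moreover have "matrix R = vector [vector [2 * R e2 $ 2, 0], vector [R e1 $ 2, R e2 $ 2]]"
      using matrix_2_eq[of R] coords(1) a by simp
    ultimately show ?thesis
      by blast
  qed
qed

end
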